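(* Let $I$ be a graded ideal of superdimension $(k\mid h)$ of the abelian Lie superalgebra $A(m\mid n)$, with $k+h\geq 1$. Then the pair $(A(m\mid n), I)$ is capable if and only if either $m=0$ and $n=1$, or $m+n\geq 2$.
   Context: All Lie superalgebras are over a field $\mathbb{F}$ of characteristic different from $2,3$. A homogeneous element $x$ has degree $|x|\in\mathbb{Z}_2$; whenever degrees appear elements are homogeneous. $A(m\mid n)$ is the abelian Lie superalgebra with even part of dimension $m$ and odd part of dimension $n$; superdimension $(k\mid h)$ means even part of dimension $k$, odd part of dimension $h$. A pair of Lie superalgebras $(L,I)$ is a Lie superalgebra $L$ with a graded ideal $I$ of $L$. Homomorphisms of Lie superalgebras are linear, even and bracket-preserving. An action of $L$ on a Lie superalgebra $N$ is an even bilinear map $L\times N\to N$, $(l,n)\mapsto {}^l n$, with ${}^{[l,l']}n={}^l({}^{l'}n)-(-1)^{|l||l'|}\,{}^{l'}({}^l n)$ and ${}^l[n,n']=[{}^l n,n']+(-1)^{|l||n|}[n,{}^l n']$. A relative central extension of $(L,I)$ is a Lie superalgebra homomorphism $\beta:N\to L$ together with an action of $L$ on $N$ such that: (1) $\beta(N)=I$; (2) $\beta({}^l n)=[l,\beta(n)]$; (3) ${}^{\beta(n_1)}n=[n_1,n]$; (4) $\ker\beta\subseteq Z[L,N]$, where $Z[L,N]=\{n\in N\mid {}^l n=0\ \forall l\in L\}$; here $l\in L$, $n,n_1\in N$. The pair $(L,I)$ is capable if it has a relative central extension $\beta:N\to L$ with $\ker\beta=Z[L,N]$. *)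

theory Defs
  imports Complex_Main "HOL-Library.Z2" "HOL-Computational_Algebra.Computational_Algebra"
begin

text \<open>
  All vector spaces are subspaces of an ambient vector space given by a type of class
  ab_group_add and a scalar multiplication satisfying the locale vector_space; linearity is
  only required on the subspaces in question.
\<close>

definition linear_on ::
  "('f::field \<Rightarrow> 'a::ab_group_add \<Rightarrow> 'a) \<Rightarrow> ('f \<Rightarrow> 'b::ab_group_add \<Rightarrow> 'b) \<Rightarrow> 'a set \<Rightarrow> ('a \<Rightarrow> 'b) \<Rightarrow> bool"
where
  "linear_on sa sb V f \<longleftrightarrow>
     (\<forall>x\<in>V. \<forall>y\<in>V. f (x + y) = f x + f y) \<and> (\<forall>c. \<forall>x\<in>V. f (sa c x) = sb c (f x))"

definition bilinear_on ::
  "('f::field \<Rightarrow> 'a::ab_group_add \<Rightarrow> 'a) \<Rightarrow> ('f \<Rightarrow> 'b::ab_group_add \<Rightarrow> 'b)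
    \<Rightarrow> ('f \<Rightarrow> 'c::ab_group_add \<Rightarrow> 'c) \<Rightarrow> 'a set \<Rightarrow> 'b set \<Rightarrow> ('a \<Rightarrow> 'b \<Rightarrow> 'c) \<Rightarrow> bool"
where
  "bilinear_on sa sb sc V W f \<longleftrightarrow>
     (\<forall>x\<in>V. linear_on sb sc W (f x)) \<and> (\<forall>y\<in>W. linear_on sa sc V (\<lambda>x. f x y))"

text \<open>
  Finite dimension \<open>d\<close>, with an explicit finite basis: the library's dim would also assign
  \<open>0\<close> to infinite-dimensional spaces.
\<close>

definition has_dim :: "('f::field \<Rightarrow> 'v::ab_group_add \<Rightarrow> 'v) \<Rightarrow> 'v set \<Rightarrow> nat \<Rightarrow> bool" where
  "has_dim s V d \<longleftrightarrow>
     (\<exists>B. finite B \<and> card B = d \<and> \<not> module.dependent s B \<and> module.span s B = V)"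

text \<open>
  The degrees are the elements of the two-element field \<open>bit\<close>; \<open>part L d\<close> is the homogeneous
  component of degree \<open>d\<close>. The zero vector lies in both components.
\<close>

record 'v superalgebra =
  part :: "bit \<Rightarrow> 'v set"
  bracket :: "'v \<Rightarrow> 'v \<Rightarrow> 'v"

definition carrier_of :: "('v::ab_group_add, 'z) superalgebra_scheme \<Rightarrow> 'v set" where
  "carrier_of L = {x + y | x y. x \<in> part L 0 \<and> y \<in> part L 1}"

text \<open>The sign $(-1)^{de}$.\<close>

definition koszul :: "bit \<Rightarrow> bit \<Rightarrow> 'f::field" where
  "koszul d e = (if d * e = 1 then - 1 else 1)"

text \<open>
  Only used over fields of characteristic different from 2 and 3, where these axioms imply
  $[x,x] = 0$ for even $x$ and $[x,[x,x]] = 0$ for odd $x$.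
\<close>

locale lie_superalgebra = vector_space scale
  for scale :: "'f::field \<Rightarrow> 'v::ab_group_add \<Rightarrow> 'v" +
  fixes L :: "'v superalgebra"
  assumes subspace_part: "subspace (part L d)"
    and direct_sum: "part L 0 \<inter> part L 1 = {0}"
    and bilinear_bracket:
      "bilinear_on scale scale scale (carrier_of L) (carrier_of L) (bracket L)"
    and bracket_degree:
      "\<lbrakk>x \<in> part L d; y \<in> part L e\<rbrakk> \<Longrightarrow> bracket L x y \<in> part L (d + e)"
    and super_skew:
      "\<lbrakk>x \<in> part L d; y \<in> part L e\<rbrakk> \<Longrightarrow> bracket L x y = - scale (koszul d e) (bracket L y x)"
    and super_jacobi:
      "\<lbrakk>x \<in> part L d; y \<in> part L e; z \<in> part L c\<rbrakk> \<Longrightarrow>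
        bracket L x (bracket L y z) =
          bracket L (bracket L x y) z + scale (koszul d e) (bracket L y (bracket L x z))"

definition superdim ::
  "('f::field \<Rightarrow> 'v::ab_group_add \<Rightarrow> 'v) \<Rightarrow> 'v superalgebra \<Rightarrow> 'v set \<Rightarrow> nat \<Rightarrow> nat \<Rightarrow> bool"
where
  "superdim s L V k h \<longleftrightarrow> has_dim s (V \<inter> part L 0) k \<and> has_dim s (V \<inter> part L 1) h"

definition graded_ideal ::
  "('f::field \<Rightarrow> 'v::ab_group_add \<Rightarrow> 'v) \<Rightarrow> 'v superalgebra \<Rightarrow> 'v set \<Rightarrow> bool"
where
  "graded_ideal s L I \<longleftrightarrow>
     module.subspace s I \<and>
     I = {x + y | x y. x \<in> I \<inter> part L 0 \<and> y \<in> I \<inter> part L 1} \<and>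
     (\<forall>l\<in>carrier_of L. \<forall>i\<in>I. bracket L l i \<in> I)"

text \<open>\<open>L\<close> is (a copy of) the abelian Lie superalgebra $A(m\mid n)$.\<close>

definition abelian_superalgebra ::
  "('f::field \<Rightarrow> 'v::ab_group_add \<Rightarrow> 'v) \<Rightarrow> 'v superalgebra \<Rightarrow> nat \<Rightarrow> nat \<Rightarrow> bool"
where
  "abelian_superalgebra s L m n \<longleftrightarrow>
     lie_superalgebra s L \<and>
     (\<forall>x\<in>carrier_of L. \<forall>y\<in>carrier_of L. bracket L x y = 0) \<and>
     superdim s L (carrier_of L) m n"

definition lie_hom ::
  "('f::field \<Rightarrow> 'n::ab_group_add \<Rightarrow> 'n) \<Rightarrow> 'n superalgebra
    \<Rightarrow> ('f \<Rightarrow> 'l::ab_group_add \<Rightarrow> 'l) \<Rightarrow> 'l superalgebra \<Rightarrow> ('n \<Rightarrow> 'l) \<Rightarrow> bool"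
where
  "lie_hom sN N sL L \<beta> \<longleftrightarrow>
     linear_on sN sL (carrier_of N) \<beta> \<and>
     (\<forall>d. \<forall>x\<in>part N d. \<beta> x \<in> part L d) \<and>
     (\<forall>x\<in>carrier_of N. \<forall>y\<in>carrier_of N. \<beta> (bracket N x y) = bracket L (\<beta> x) (\<beta> y))"

definition lie_action ::
  "('f::field \<Rightarrow> 'l::ab_group_add \<Rightarrow> 'l) \<Rightarrow> 'l superalgebra
    \<Rightarrow> ('f \<Rightarrow> 'n::ab_group_add \<Rightarrow> 'n) \<Rightarrow> 'n superalgebra \<Rightarrow> ('l \<Rightarrow> 'n \<Rightarrow> 'n) \<Rightarrow> bool"
where
  "lie_action sL L sN N act \<longleftrightarrow>
     bilinear_on sL sN sN (carrier_of L) (carrier_of N) act \<and>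
     (\<forall>d e. \<forall>l\<in>part L d. \<forall>n\<in>part N e. act l n \<in> part N (d + e)) \<and>
     (\<forall>d d'. \<forall>l\<in>part L d. \<forall>l'\<in>part L d'. \<forall>n\<in>carrier_of N.
        act (bracket L l l') n = act l (act l' n) - sN (koszul d d') (act l' (act l n))) \<and>
     (\<forall>d e. \<forall>l\<in>part L d. \<forall>n\<in>part N e. \<forall>n'\<in>carrier_of N.
        act l (bracket N n n') =
          bracket N (act l n) n' + sN (koszul d e) (bracket N n (act l n')))"

definition ker_on :: "'n superalgebra \<Rightarrow> ('n::ab_group_add \<Rightarrow> 'l::ab_group_add) \<Rightarrow> 'n set" where
  "ker_on N \<beta> = {n \<in> carrier_of N. \<beta> n = 0}"

text \<open>The set $Z[L,N]$ of elements annihilated by the action.\<close>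

definition act_centre ::
  "'l::ab_group_add superalgebra \<Rightarrow> 'n::ab_group_add superalgebra \<Rightarrow> ('l \<Rightarrow> 'n \<Rightarrow> 'n) \<Rightarrow> 'n set"
where
  "act_centre L N act = {n \<in> carrier_of N. \<forall>l\<in>carrier_of L. act l n = 0}"

definition relative_central_extension ::
  "('f::field \<Rightarrow> 'l::ab_group_add \<Rightarrow> 'l) \<Rightarrow> 'l superalgebra \<Rightarrow> 'l set
    \<Rightarrow> ('f \<Rightarrow> 'n::ab_group_add \<Rightarrow> 'n) \<Rightarrow> 'n superalgebra \<Rightarrow> ('n \<Rightarrow> 'l) \<Rightarrow> ('l \<Rightarrow> 'n \<Rightarrow> 'n) \<Rightarrow> bool"
where
  "relative_central_extension sL L I sN N \<beta> act \<longleftrightarrow>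
     lie_superalgebra sN N \<and> lie_hom sN N sL L \<beta> \<and> lie_action sL L sN N act \<and>
     \<beta> ` carrier_of N = I \<and>
     (\<forall>l\<in>carrier_of L. \<forall>n\<in>carrier_of N. \<beta> (act l n) = bracket L l (\<beta> n)) \<and>
     (\<forall>n1\<in>carrier_of N. \<forall>n\<in>carrier_of N. act (\<beta> n1) n = bracket N n1 n) \<and>
     ker_on N \<beta> \<subseteq> act_centre L N act"

text \<open>
  HOL cannot quantify existentially over types, so the extensions \<open>N\<close> range over the Lie
  superalgebras whose underlying vector space is a subspace of the ambient space \<open>sN\<close>. That
  space has to be large enough: in a small one (say the zero space) no pair with nonzero ideal
  has an extension at all. When a statement about capable holds for every infinite-dimensional
  ambient space, nothing is lost: a Lie superalgebra of infinite dimension may be its own ambient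
  space, and a finite-dimensional one embeds in every infinite-dimensional space.
\<close>

definition capable ::
  "('f::field \<Rightarrow> 'n::ab_group_add \<Rightarrow> 'n) \<Rightarrow> ('f \<Rightarrow> 'l::ab_group_add \<Rightarrow> 'l) \<Rightarrow> 'l superalgebra \<Rightarrow> 'l set \<Rightarrow> bool"
where
  "capable sN sL L I \<longleftrightarrow>
     (\<exists>N \<beta> act. relative_central_extension sL L I sN N \<beta> act \<and> ker_on N \<beta> = act_centre L N act)"

definition infinite_dimensional :: "('f::field \<Rightarrow> 'v::ab_group_add \<Rightarrow> 'v) \<Rightarrow> bool" where
  "infinite_dimensional s \<longleftrightarrow> vector_space s \<and> (\<exists>B. infinite B \<and> \<not> module.dependent s B)"

end

theory Submission
  imports Defs
begin

text \<open>
  Write \<open>L\<close> for the abelian superalgebra and \<open>I\<close> for its nonzero graded ideal. The only case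
  compatible with \<open>k + h \<ge> 1\<close> that the condition on \<open>(m, n)\<close> excludes is \<open>(m, n) = (1, 0)\<close>, and the
  obstruction there is $[a,a] = 0$ for even \<open>a\<close>: the algebra \<open>L\<close> is a line through some \<open>z \<in> I\<close>, and
  for an even lift \<open>a\<close> of \<open>z\<close> the action of \<open>z\<close> on \<open>a\<close> is the bracket of \<open>a\<close> with itself, hence zero.
  So all of \<open>L\<close> annihilates \<open>a\<close>, although \<open>a\<close> is not in the kernel
  (\<open>not_capable_if_even_line\<close>). An odd line escapes because $[a,a]$ may be nonzero for odd \<open>a\<close>.

  In all other cases there is a super skew-symmetric bilinear form \<open>f\<close> on \<open>L\<close> without radical,
  with values in \<open>L\<close> or in \<open>L\<close> with its parity shifted. Such a form gives the extension
  \<open>N = I \<oplus> L\<close>, where the second summand is central and receives all brackets and actions,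
  $[i + w, i' + w'] = f(i,i')$ and ${}^l(i + w) = f(l,i)$, and \<open>\<beta>\<close> is the projection to \<open>I\<close>. All double
  products vanish, so the axioms that involve them are trivial, and \<open>i + w\<close> is annihilated by \<open>L\<close>
  exactly if \<open>i\<close> is in the radical of \<open>f\<close>, that is, if \<open>i = 0\<close> (\<open>capable_if_nondegenerate_form\<close>).

  For \<open>m \<ge> 1\<close> a nonzero even functional \<open>\<phi>\<close> on \<open>L\<close> gives the form $f(x,y) = \phi(x) y - \phi(y) x$, whose
  radical is zero as soon as \<open>L\<close> is not a line. For \<open>m = 0\<close> the algebra is purely odd, where super
  skew-symmetric means symmetric, and a nonzero odd functional gives
  $f(x,y) = \phi(x) y + \phi(y) x$, whose radical is zero because 2 is invertible.
\<close>

section \<open>Bases of the homogeneous components\<close>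

lemma (in vector_space) independent_Un_if_spans_disjoint:
  assumes B: "independent B" and C: "independent C" and BC: "span B \<inter> span C = {0}"
  shows "independent (B \<union> C)"
  unfolding independent_explicit_module
proof (intro allI impI)
  fix t u v
  assume t: "finite t" "t \<subseteq> B \<union> C" "(\<Sum>v\<in>t. scale (u v) v) = 0" "v \<in> t"
  have split: "(\<Sum>v\<in>t. scale (u v) v) = (\<Sum>v\<in>t \<inter> B. scale (u v) v) + (\<Sum>v\<in>t - B. scale (u v) v)"
    using t(1) by (rule sum.Int_Diff)
  have b: "(\<Sum>v\<in>t \<inter> B. scale (u v) v) \<in> span B"
    by (intro span_sum span_scale span_base) auto
  have c: "(\<Sum>v\<in>t - B. scale (u v) v) \<in> span C"
    using t(2) by (intro span_sum span_scale span_base) auto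
  have eq: "(\<Sum>v\<in>t \<inter> B. scale (u v) v) = - (\<Sum>v\<in>t - B. scale (u v) v)"
    using split t(3) by (simp add: eq_neg_iff_add_eq_0)
  with b c have "(\<Sum>v\<in>t \<inter> B. scale (u v) v) \<in> span B \<inter> span C"
    by (metis Int_iff span_neg)
  hence zero: "(\<Sum>v\<in>t \<inter> B. scale (u v) v) = 0" "(\<Sum>v\<in>t - B. scale (u v) v) = 0"
    using BC eq by auto
  show "u v = 0"
  proof (cases "v \<in> B")
    case True
    then show ?thesis using independentD[OF B _ _ zero(1)] t by auto
  next
    case False
    then show ?thesis using independentD[OF C _ _ zero(2)] t by auto
  qed
qed

context lie_superalgebra
begin

lemma zero_in_part: "0 \<in> part L d"
  using subspace_part subspace_0 by blast

lemma part_subset_carrier: "part L d \<subseteq> carrier_of L"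
proof
  fix x assume "x \<in> part L d"
  then show "x \<in> carrier_of L"
    unfolding carrier_of_def using zero_in_part[of 0] zero_in_part[of 1]
    by (cases d) force+
qed

lemma subspace_carrier: "subspace (carrier_of L)"
  unfolding carrier_of_def using subspace_sums[OF subspace_part subspace_part] .

end

text \<open>
  One basis of the whole space, adapted to the grading. It is a function of the degree so that even
  and odd coordinates can be treated at once.
\<close>

lemma abelian_superalgebra_basis:
  assumes "abelian_superalgebra s L m n"
  obtains B where "finite (B 0 \<union> B 1)" "\<not> module.dependent s (B 0 \<union> B 1)"
    "\<And>d. module.span s (B d) = part L d" "module.span s (B 0 \<union> B 1) = carrier_of L"
    "B 0 \<inter> B 1 = {}" "card (B 0) = m" "card (B 1) = n"
proof -
  interpret L: lie_superalgebra s L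
    using assms by (simp add: abelian_superalgebra_def)
  have carr: "carrier_of L \<inter> part L d = part L d" for d
    using L.part_subset_carrier by auto
  obtain B0 B1 where B0: "finite B0" "card B0 = m" "L.independent B0" "L.span B0 = part L 0"
    and B1: "finite B1" "card B1 = n" "L.independent B1" "L.span B1 = part L 1"
    using assms by (auto simp: abelian_superalgebra_def superdim_def has_dim_def carr)
  define B :: "bit \<Rightarrow> 'b set" where "B d = (if d = 0 then B0 else B1)" for d
  have "B0 \<inter> B1 \<subseteq> {0}"
    using B0(4) B1(4) L.direct_sum L.span_superset by blast
  hence "B0 \<inter> B1 = {}"
    using B0(3) L.dependent_zero by blast
  show ?thesis
  proof
    show "L.independent (B 0 \<union> B 1)"
      using L.independent_Un_if_spans_disjoint[of B0 B1] B0 B1 L.direct_sum by (simp add: B_def)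
    show "L.span (B d) = part L d" for d
      by (cases d) (use B0 B1 in \<open>auto simp: B_def\<close>)
    show "L.span (B 0 \<union> B 1) = carrier_of L"
      using B0 B1 by (simp add: B_def L.span_Un carrier_of_def)
  qed (use B0 B1 \<open>B0 \<inter> B1 = {}\<close> in \<open>auto simp: B_def\<close>)
qed

section \<open>Capability from a nondegenerate super skew-symmetric form\<close>

text \<open>
  The direct sum of two copies of a finite-dimensional space embeds in every infinite-dimensional
  one: a large enough independent set holds two disjoint copies of the basis. Here \<open>\<iota>\<close> and \<open>\<kappa>\<close> are
  the two embeddings and \<open>\<beta>\<close> is the projection to the first copy; \<open>\<gamma>\<close> is a left inverse of \<open>\<kappa>\<close> that
  records its injectivity. All four maps are linear on the full ambient spaces, so that they can be
  used without tracking domains.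
\<close>

lemma two_copies_in_infinite_dimensional:
  fixes sL :: "'f::field \<Rightarrow> 'l::ab_group_add \<Rightarrow> 'l" and sN :: "'f \<Rightarrow> 'n::ab_group_add \<Rightarrow> 'n"
  assumes "vector_space sL" "infinite_dimensional sN" "finite B" "\<not> module.dependent sL B"
  obtains \<iota> \<kappa> :: "'l \<Rightarrow> 'n" and \<beta> \<gamma> :: "'n \<Rightarrow> 'l"
  where "Vector_Spaces.linear sL sN \<iota>" "Vector_Spaces.linear sL sN \<kappa>"
    "Vector_Spaces.linear sN sL \<beta>" "Vector_Spaces.linear sN sL \<gamma>"
    "\<And>x. x \<in> module.span sL B \<Longrightarrow> \<beta> (\<iota> x) = x" "\<And>x. x \<in> module.span sL B \<Longrightarrow> \<beta> (\<kappa> x) = 0"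
    "\<And>x. x \<in> module.span sL B \<Longrightarrow> \<gamma> (\<kappa> x) = x"
proof -
  interpret L: vector_space sL by fact
  interpret N: vector_space sN using assms(2) by (simp add: infinite_dimensional_def)
  interpret LN: vector_space_pair sL sN ..
  interpret NL: vector_space_pair sN sL ..
  interpret LL: vector_space_pair sL sL ..
  obtain C where C: "infinite C" "N.independent C"
    using assms(2) by (auto simp: infinite_dimensional_def)
  obtain D where D: "D \<subseteq> C" "finite D" "card D = card (B \<times> (UNIV :: bool set))"
    using infinite_arbitrarily_large[OF C(1)] by metis
  obtain g where g: "bij_betw g (B \<times> (UNIV :: bool set)) D"
    using finite_same_card_bij[of "B \<times> (UNIV :: bool set)" D] D assms(3) by auto
  define g' where "g' = the_inv_into (B \<times> (UNIV :: bool set)) g"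
  have g': "g' (g (b, i)) = (b, i)" if "b \<in> B" for b i
    using that g unfolding g'_def by (intro the_inv_into_f_f) (auto simp: bij_betw_def)
  have gD: "g (b, i) \<in> D" if "b \<in> B" for b i
    using that g by (auto simp: bij_betw_def)
  have iD: "N.independent D" using C(2) D(1) N.independent_mono by blast
  obtain \<iota> where \<iota>: "Vector_Spaces.linear sL sN \<iota>" "\<And>b. b \<in> B \<Longrightarrow> \<iota> b = g (b, False)"
    using LN.linear_independent_extend[OF assms(4), of "\<lambda>b. g (b, False)"] by auto
  obtain \<kappa> where \<kappa>: "Vector_Spaces.linear sL sN \<kappa>" "\<And>b. b \<in> B \<Longrightarrow> \<kappa> b = g (b, True)"
    using LN.linear_independent_extend[OF assms(4), of "\<lambda>b. g (b, True)"] by auto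
  obtain \<beta> where \<beta>: "Vector_Spaces.linear sN sL \<beta>"
    "\<And>v. v \<in> D \<Longrightarrow> \<beta> v = (if snd (g' v) then 0 else fst (g' v))"
    using NL.linear_independent_extend[OF iD, of "\<lambda>v. if snd (g' v) then 0 else fst (g' v)"] by auto
  obtain \<gamma> where \<gamma>: "Vector_Spaces.linear sN sL \<gamma>" "\<And>v. v \<in> D \<Longrightarrow> \<gamma> v = fst (g' v)"
    using NL.linear_independent_extend[OF iD, of "\<lambda>v. fst (g' v)"] by auto
  show ?thesis
  proof (rule that[OF \<iota>(1) \<kappa>(1) \<beta>(1) \<gamma>(1)])
    fix x assume x: "x \<in> L.span B"
    have "(\<beta> \<circ> \<iota>) x = id x"
    proof (rule LL.linear_eq_on[OF Vector_Spaces.linear_compose[OF \<iota>(1) \<beta>(1)] L.linear_id x])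
      show "(\<beta> \<circ> \<iota>) b = id b" if "b \<in> B" for b
        using that by (simp add: \<iota>(2) \<beta>(2) g' gD)
    qed
    then show "\<beta> (\<iota> x) = x" by simp
    have "(\<beta> \<circ> \<kappa>) x = (\<lambda>_. 0) x"
    proof (rule LL.linear_eq_on[OF Vector_Spaces.linear_compose[OF \<kappa>(1) \<beta>(1)] LL.linear_zero x])
      show "(\<beta> \<circ> \<kappa>) b = (\<lambda>_. 0) b" if "b \<in> B" for b
        using that by (simp add: \<kappa>(2) \<beta>(2) g' gD)
    qed
    then show "\<beta> (\<kappa> x) = 0" by simp
    have "(\<gamma> \<circ> \<kappa>) x = id x"
    proof (rule LL.linear_eq_on[OF Vector_Spaces.linear_compose[OF \<kappa>(1) \<gamma>(1)] L.linear_id x])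
      show "(\<gamma> \<circ> \<kappa>) b = id b" if "b \<in> B" for b
        using that by (simp add: \<kappa>(2) \<gamma>(2) g' gD)
    qed
    then show "\<gamma> (\<kappa> x) = x" by simp
  qed
qed

text \<open>
  The form \<open>f\<close> plays the part of the exterior square of \<open>L\<close>, cut down to values in a copy of \<open>L\<close> itself.
  The degree \<open>s\<close> of \<open>f\<close> is absorbed by shifting the grading of that copy, so that
  the bracket of \<open>N\<close> is even in either case. As \<open>f\<close> is defined on \<open>L\<close>, not only on \<open>I\<close>,
  one form serves all graded ideals.
\<close>

lemma capable_if_nondegenerate_form:
  fixes sL :: "'f::field \<Rightarrow> 'l::ab_group_add \<Rightarrow> 'l" and sN :: "'f \<Rightarrow> 'n::ab_group_add \<Rightarrow> 'n"
  assumes inf: "infinite_dimensional sN" and ab: "abelian_superalgebra sL L m n"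
    and ideal: "graded_ideal sL L I"
    and bil: "bilinear_on sL sL sL (carrier_of L) (carrier_of L) f"
    and deg: "\<And>x y d e. x \<in> part L d \<Longrightarrow> y \<in> part L e \<Longrightarrow> f x y \<in> part L (d + e + s)"
    and skew: "\<And>x y d e. x \<in> part L d \<Longrightarrow> y \<in> part L e \<Longrightarrow> f x y = - sL (koszul d e) (f y x)"
    and nondeg: "\<And>y. y \<in> carrier_of L \<Longrightarrow> (\<And>x. x \<in> carrier_of L \<Longrightarrow> f x y = 0) \<Longrightarrow> y = 0"
  shows "capable sN sL L I"
proof -
  interpret L: lie_superalgebra sL L
    using ab by (simp add: abelian_superalgebra_def)
  interpret N: vector_space sN using inf by (simp add: infinite_dimensional_def)
  obtain B where B: "finite B" "L.independent B" "L.span B = carrier_of L"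
    by (rule abelian_superalgebra_basis[OF ab])
  obtain \<iota> \<kappa> :: "'l \<Rightarrow> 'n" and \<beta> \<gamma> :: "'n \<Rightarrow> 'l" where lin:
    "Vector_Spaces.linear sL sN \<iota>" "Vector_Spaces.linear sL sN \<kappa>"
    "Vector_Spaces.linear sN sL \<beta>" "Vector_Spaces.linear sN sL \<gamma>"
    and \<beta>\<iota>: "\<And>x. x \<in> carrier_of L \<Longrightarrow> \<beta> (\<iota> x) = x"
    and \<beta>\<kappa>: "\<And>x. x \<in> carrier_of L \<Longrightarrow> \<beta> (\<kappa> x) = 0"
    and \<gamma>\<kappa>: "\<And>x. x \<in> carrier_of L \<Longrightarrow> \<gamma> (\<kappa> x) = x"
    by (rule two_copies_in_infinite_dimensional[OF L.vector_space_axioms inf B(1,2), unfolded B(3)])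
      blast
  interpret \<iota>: Vector_Spaces.linear sL sN \<iota> by fact
  interpret \<kappa>: Vector_Spaces.linear sL sN \<kappa> by fact
  interpret \<beta>: Vector_Spaces.linear sN sL \<beta> by fact
  interpret \<gamma>: Vector_Spaces.linear sN sL \<gamma> by fact
  let ?V = "carrier_of L"
  have br0: "bracket L x y = 0" if "x \<in> ?V" "y \<in> ?V" for x y
    using ab that by (simp add: abelian_superalgebra_def)
  have subI: "L.subspace I"
    using ideal unfolding graded_ideal_def by (rule conjunct1)
  have "I = {x + y | x y. x \<in> I \<inter> part L 0 \<and> y \<in> I \<inter> part L 1}"
    using ideal unfolding graded_ideal_def by (elim conjE)
  hence I: "\<exists>x0 x1. x = x0 + x1 \<and> x0 \<in> I \<inter> part L 0 \<and> x1 \<in> I \<inter> part L 1" if "x \<in> I" for x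
    using that by blast
  have IV: "I \<subseteq> ?V"
    using I unfolding carrier_of_def by blast
  note pV = subsetD[OF L.part_subset_carrier]
  note V_add = L.subspace_add[OF L.subspace_carrier]
  have V0: "0 \<in> ?V" using L.subspace_carrier L.subspace_0 by blast
  have f_add: "f (x + y) z = f x z + f y z" "f z (x + y) = f z x + f z y"
    if "x \<in> ?V" "y \<in> ?V" "z \<in> ?V" for x y z
    using bil that by (auto simp: bilinear_on_def linear_on_def)
  have f_scale: "f (sL c x) z = sL c (f x z)" "f z (sL c x) = sL c (f z x)"
    if "x \<in> ?V" "z \<in> ?V" for x z c
    using bil that by (auto simp: bilinear_on_def linear_on_def)
  have f0: "f 0 x = 0" "f x 0 = 0" if "x \<in> ?V" for x
    using f_add[OF V0 V0 that] by simp_all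
  have fV: "f x y \<in> ?V" if xy: "x \<in> ?V" "y \<in> ?V" for x y
  proof -
    obtain x0 x1 y0 y1 where *: "x = x0 + x1" "y = y0 + y1"
      "x0 \<in> part L 0" "x1 \<in> part L 1" "y0 \<in> part L 0" "y1 \<in> part L 1"
      using xy by (auto simp: carrier_of_def)
    have "f x y = (f x0 y0 + f x0 y1) + (f x1 y0 + f x1 y1)"
      using * pV xy by (simp add: f_add)
    then show ?thesis
      using * by (auto intro!: V_add pV[OF deg])
  qed
  \<comment> \<open>The homogeneous components of \<open>N = I \<oplus> L\<close>, with \<open>\<iota>\<close> embedding \<open>I\<close> and \<open>\<kappa>\<close> embedding the shifted
      copy of \<open>L\<close>.\<close>
  define P :: "bit \<Rightarrow> 'n set" where
    "P d = {\<iota> x + \<kappa> w | x w. x \<in> I \<inter> part L d \<and> w \<in> part L (d + s)}" for d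
  define act where "act l u = \<kappa> (f l (\<beta> u))" for l u
  define N where "N = \<lparr>part = P, bracket = (\<lambda>u v. \<kappa> (f (\<beta> u) (\<beta> v)))\<rparr>"
  have partN: "part N = P" and brN: "bracket N u v = \<kappa> (f (\<beta> u) (\<beta> v))" for u v
    by (simp_all add: N_def)
  have \<beta>P: "\<beta> u \<in> I \<inter> part L d" if "u \<in> P d" for u d
    using that pV by (auto simp: P_def \<beta>.add \<beta>\<iota> \<beta>\<kappa>)
  have \<kappa>P: "\<kappa> w \<in> P d" if "w \<in> part L (d + s)" for w d
    unfolding P_def using that L.subspace_0[OF subI] L.zero_in_part \<iota>.zero by force
  have subP: "N.subspace (P d)" for d
    unfolding N.subspace_def
  proof (intro conjI ballI allI)
    show "0 \<in> P d" using \<kappa>P[of 0] L.zero_in_part \<kappa>.zero by metis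
  next
    fix u v assume "u \<in> P d" "v \<in> P d"
    then obtain x w x' w' where *: "u = \<iota> x + \<kappa> w" "v = \<iota> x' + \<kappa> w'" "x \<in> I" "x' \<in> I"
      "x \<in> part L d" "x' \<in> part L d" "w \<in> part L (d + s)" "w' \<in> part L (d + s)"
      by (auto simp: P_def)
    have "u + v = \<iota> (x + x') + \<kappa> (w + w')" using * by (simp add: \<iota>.add \<kappa>.add)
    moreover have "x + x' \<in> I \<inter> part L d" "w + w' \<in> part L (d + s)"
      using * L.subspace_add L.subspace_part subI by auto
    ultimately show "u + v \<in> P d" unfolding P_def by blast
  next
    fix c u assume "u \<in> P d"
    then obtain x w where *: "u = \<iota> x + \<kappa> w" "x \<in> I" "x \<in> part L d" "w \<in> part L (d + s)"
      by (auto simp: P_def)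
    have "sN c u = \<iota> (sL c x) + \<kappa> (sL c w)" 
      using * by (simp add: \<iota>.scale \<kappa>.scale N.scale_right_distrib)
    moreover have "sL c x \<in> I \<inter> part L d" "sL c w \<in> part L (d + s)"
      using * L.subspace_scale L.subspace_part subI by auto
    ultimately show "sN c u \<in> P d" unfolding P_def by blast
  qed
  have carrN: "carrier_of N = {x + y | x y. x \<in> P 0 \<and> y \<in> P 1}"
    by (simp add: carrier_of_def partN)
  have PN: "P d \<subseteq> carrier_of N" for d
  proof
    fix u assume "u \<in> P d"
    then show "u \<in> carrier_of N"
      unfolding carrN using N.subspace_0[OF subP[of 0]] N.subspace_0[OF subP[of 1]]
      by (cases d) force+
  qed
  have \<beta>N: "\<beta> u \<in> I" if "u \<in> carrier_of N" for u
    using that \<beta>P L.subspace_add[OF subI] by (fastforce simp: carrN \<beta>.add)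
  have \<beta>V: "\<beta> u \<in> ?V" if "u \<in> carrier_of N" for u
    using \<beta>N[OF that] IV by auto
  have \<beta>Vp: "\<beta> u \<in> part L d" "\<beta> u \<in> ?V" if "u \<in> P d" for u d
    using \<beta>P[OF that] IV by auto
  have brP: "\<kappa> (f x y) \<in> P (d + e)" if "x \<in> part L d" "y \<in> part L e" for x y d e
    using \<kappa>P deg[OF that] by blast
  have \<kappa>eq0: "w = 0" if "\<kappa> w = 0" "w \<in> ?V" for w
    using that \<gamma>\<kappa>[of w] \<gamma>.zero by simp
  have "lie_superalgebra sN N"
  proof unfold_locales
    show "N.subspace (part N d)" for d unfolding partN by (rule subP)
    show "part N 0 \<inter> part N 1 = {0}"
      unfolding partN
    proof (intro equalityI subsetI)
      fix u assume u: "u \<in> P 0 \<inter> P 1"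
      have "\<beta> u \<in> part L 0 \<inter> part L 1" using u \<beta>Vp by blast
      hence b: "\<beta> u = 0" using L.direct_sum by simp
      \<comment> \<open>A vector in both components projects to \<open>0\<close> in \<open>I\<close>, so it lies in the copy of \<open>L\<close>, where the
          degrees are again disjoint.\<close>
      have shape: "u = \<kappa> (\<gamma> u) \<and> \<gamma> u \<in> part L (d + s)" if ud: "u \<in> P d" for d
      proof -
        obtain x w where *: "u = \<iota> x + \<kappa> w" "x \<in> part L d" "w \<in> part L (d + s)"
          using ud unfolding P_def by blast
        have "x = 0" using b * pV by (auto simp: \<beta>.add \<beta>\<iota> \<beta>\<kappa>)
        then show ?thesis using * pV by (auto simp: \<gamma>\<kappa> \<iota>.zero)
      qed
      have "\<gamma> u \<in> part L 0 \<inter> part L 1"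
        using shape[of 0] shape[of 1] u by (cases s) auto
      hence "\<gamma> u = 0" using L.direct_sum by simp
      then show "u \<in> {0}" using shape[of 0] u \<kappa>.zero by simp
    qed (use N.subspace_0[OF subP] in auto)
    show "bilinear_on sN sN sN (carrier_of N) (carrier_of N) (bracket N)"
      by (auto simp: bilinear_on_def linear_on_def brN \<beta>.add \<beta>.scale \<beta>V f_add f_scale \<kappa>.add \<kappa>.scale)
    show "bracket N x y \<in> part N (d + e)" if "x \<in> part N d" "y \<in> part N e" for x y d e
      using that brP \<beta>Vp unfolding partN brN by blast
    show "bracket N x y = - sN (koszul d e) (bracket N y x)"
      if "x \<in> part N d" "y \<in> part N e" for x y d e
      using skew[of "\<beta> x" d "\<beta> y" e] that \<beta>Vp by (simp add: partN brN \<kappa>.neg \<kappa>.scale)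
    show "bracket N x (bracket N y z) =
        bracket N (bracket N x y) z + sN (koszul d e) (bracket N y (bracket N x z))"
      if "x \<in> part N d" "y \<in> part N e" "z \<in> part N c" for x y z d e c
      using that by (simp add: partN brN \<beta>Vp fV \<beta>\<kappa> f0 \<kappa>.zero)
  qed
  moreover have "lie_hom sN N sL L \<beta>"
    by (auto simp: lie_hom_def linear_on_def \<beta>.add \<beta>.scale partN \<beta>Vp brN \<beta>V br0 fV \<beta>\<kappa>)
  moreover have "lie_action sL L sN N act"
    unfolding lie_action_def
  proof (intro conjI allI ballI)
    show "bilinear_on sL sN sN ?V (carrier_of N) act"
      by (auto simp: bilinear_on_def linear_on_def act_def \<beta>.add \<beta>.scale \<beta>V f_add f_scale
          \<kappa>.add \<kappa>.scale)
    show "act l u \<in> part N (d + e)" if "l \<in> part L d" "u \<in> part N e" for l u d e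
      using that unfolding partN act_def by (intro brP \<beta>Vp)
    show "act (bracket L l l') u = act l (act l' u) - sN (koszul d d') (act l' (act l u))"
      if "l \<in> part L d" "l' \<in> part L d'" "u \<in> carrier_of N" for l l' u d d'
      using that pV by (simp add: act_def br0 \<beta>V fV \<beta>\<kappa> f0 \<kappa>.zero)
    show "act l (bracket N u v) = bracket N (act l u) v + sN (koszul d e) (bracket N u (act l v))"
      if "l \<in> part L d" "u \<in> part N e" "v \<in> carrier_of N" for l u v d e
      using that pV by (simp add: act_def partN brN \<beta>V \<beta>Vp fV \<beta>\<kappa> f0 \<kappa>.zero)
  qed
  moreover have "\<beta> ` carrier_of N = I"
  proof (intro equalityI subsetI)
    fix x assume "x \<in> I"
    then obtain x0 x1 where x: "x = x0 + x1" "x0 \<in> I \<inter> part L 0" "x1 \<in> I \<inter> part L 1"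
      using I by blast
    have "\<iota> x0 \<in> P 0" "\<iota> x1 \<in> P 1"
      unfolding P_def using x L.zero_in_part \<kappa>.zero by force+
    hence "\<iota> x0 + \<iota> x1 \<in> carrier_of N" by (auto simp: carrN)
    moreover have "\<beta> (\<iota> x0 + \<iota> x1) = x" using x by (simp add: \<beta>.add \<beta>\<iota> subsetD[OF IV])
    ultimately show "x \<in> \<beta> ` carrier_of N" by (metis imageI)
  qed (use \<beta>N in auto)
  moreover have "\<forall>l\<in>?V. \<forall>u\<in>carrier_of N. \<beta> (act l u) = bracket L l (\<beta> u)"
    by (simp add: act_def \<beta>\<kappa> fV \<beta>V br0)
  moreover have "\<forall>u\<in>carrier_of N. \<forall>v\<in>carrier_of N. act (\<beta> u) v = bracket N u v"
    by (simp add: act_def brN)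
  moreover have "ker_on N \<beta> = act_centre L N act"
  proof -
    have "\<beta> u = 0 \<longleftrightarrow> (\<forall>l\<in>?V. act l u = 0)" if u: "u \<in> carrier_of N" for u
    proof
      assume *: "\<forall>l\<in>?V. act l u = 0"
      show "\<beta> u = 0"
      proof (rule nondeg[OF \<beta>V[OF u]])
        show "f l (\<beta> u) = 0" if "l \<in> ?V" for l
          using * that \<kappa>eq0 fV \<beta>V[OF u] by (auto simp: act_def)
      qed
    qed (simp add: act_def f0 \<kappa>.zero)
    then show ?thesis by (auto simp: ker_on_def act_centre_def)
  qed
  ultimately show ?thesis
    unfolding capable_def relative_central_extension_def by blast
qed

section \<open>Forms without radical\<close>

text \<open>
  A coordinate functional for a homogeneous basis vector \<open>b\<close>. The last clause is what the
  assumption on \<open>m + n\<close> contributes to the form for \<open>m > 0\<close>: another basis vector is a nonzero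
  element of the kernel.
\<close>

lemma homogeneous_functional:
  fixes sL :: "'f::field \<Rightarrow> 'l::ab_group_add \<Rightarrow> 'l"
  assumes ab: "abelian_superalgebra sL L m n" and pos: "(if s = 0 then m else n) > 0"
  obtains b \<phi> where "Vector_Spaces.linear sL (*) \<phi>" "b \<in> part L s" "\<phi> b = 1"
    "\<And>x. x \<in> part L (s + 1) \<Longrightarrow> \<phi> x = 0"
    "m + n \<ge> 2 \<Longrightarrow> \<exists>x\<in>carrier_of L. x \<noteq> 0 \<and> \<phi> x = 0"
proof -
  interpret L: lie_superalgebra sL L
    using ab by (simp add: abelian_superalgebra_def)
  interpret F: vector_space "(*) :: 'f \<Rightarrow> 'f \<Rightarrow> 'f"
    by unfold_locales (auto simp: algebra_simps)
  interpret LF: vector_space_pair sL "(*) :: 'f \<Rightarrow> 'f \<Rightarrow> 'f" ..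
  obtain B where B: "finite (B 0 \<union> B 1)" "L.independent (B 0 \<union> B 1)"
    "\<And>d. L.span (B d) = part L d" "L.span (B 0 \<union> B 1) = carrier_of L"
    "B 0 \<inter> B 1 = {}" "card (B 0) = m" "card (B 1) = n"
    by (rule abelian_superalgebra_basis[OF ab]) blast
  have "card (B s) > 0" using pos B(6,7) by (cases s) auto
  then obtain b where b: "b \<in> B s" by (metis card_gt_0_iff ex_in_conv)
  have bB: "b \<in> B 0 \<union> B 1" using b by (cases s) auto
  obtain \<phi> where \<phi>: "Vector_Spaces.linear sL (*) \<phi>"
    "\<And>x. x \<in> B 0 \<union> B 1 \<Longrightarrow> \<phi> x = (if x = b then 1 else 0)"
    using LF.linear_independent_extend[OF B(2), of "\<lambda>x. if x = b then 1 else 0"] by auto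
  show ?thesis
  proof (rule that[OF \<phi>(1), of b])
    show "b \<in> part L s" using b B(3) L.span_base by blast
    show "\<phi> b = 1" using \<phi>(2)[OF bB] by simp
    show "\<phi> x = 0" if "x \<in> part L (s + 1)" for x
    proof -
      have "x \<in> L.span (B (s + 1))" using that B(3) by simp
      moreover have "\<phi> y = 0" if "y \<in> B (s + 1)" for y
        using that b \<phi>(2)[of y] B(5) by (cases s) auto
      ultimately show ?thesis
        using LF.linear_eq_on[OF \<phi>(1) LF.linear_zero] by blast
    qed
    show "\<exists>x\<in>carrier_of L. x \<noteq> 0 \<and> \<phi> x = 0" if "m + n \<ge> 2"
    proof -
      have "card (B 0 \<union> B 1) \<ge> 2" using B that by (simp add: card_Un_disjoint)
      hence "\<not> B 0 \<union> B 1 \<subseteq> {b}"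
        using card_mono[of "{b}" "B 0 \<union> B 1"] by auto
      then obtain x where x: "x \<in> B 0 \<union> B 1" "x \<noteq> b" by blast
      moreover have "x \<noteq> 0" using x B(2) L.dependent_zero by metis
      moreover have "x \<in> carrier_of L" using x B(4) L.span_base by metis
      ultimately show ?thesis using \<phi>(2) by auto
    qed
  qed
qed

text \<open>
  If \<open>y\<close> is in the radical of $f(x,y) = \phi(x) y - \phi(y) x$, then \<open>x = b\<close> with $\phi(b) = 1$ shows
  $y = \phi(y) b$, and a nonzero \<open>x\<close> with $\phi(x) = 0$ shows $\phi(y) = 0$.
\<close>

lemma capable_if_even_part_nonzero:
  fixes sL :: "'f::field \<Rightarrow> 'l::ab_group_add \<Rightarrow> 'l" and sN :: "'f \<Rightarrow> 'n::ab_group_add \<Rightarrow> 'n"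
  assumes "infinite_dimensional sN" and ab: "abelian_superalgebra sL L m n"
    and "graded_ideal sL L I" and "m > 0" "m + n \<ge> 2"
  shows "capable sN sL L I"
proof -
  interpret L: lie_superalgebra sL L
    using ab by (simp add: abelian_superalgebra_def)
  obtain b \<phi> x1 where \<phi>: "Vector_Spaces.linear sL (*) \<phi>" "b \<in> part L 0" "\<phi> b = 1"
    "\<And>x. x \<in> part L 1 \<Longrightarrow> \<phi> x = 0" and x1: "x1 \<in> carrier_of L" "x1 \<noteq> 0" "\<phi> x1 = 0"
    by (rule homogeneous_functional[OF ab, of 0]) (use assms(4,5) in auto)
  interpret \<phi>: Vector_Spaces.linear sL "(*)" \<phi> by fact
  define f where "f x y = sL (\<phi> x) y - sL (\<phi> y) x" for x y
  note part_scale = L.subspace_scale[OF L.subspace_part]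
  note part_diff = L.subspace_diff[OF L.subspace_part]
  note part_neg = L.subspace_neg[OF L.subspace_part]
  show ?thesis
  proof (rule capable_if_nondegenerate_form[OF assms(1-3), where f = f and s = 0])
    show "bilinear_on sL sL sL (carrier_of L) (carrier_of L) f"
      by (auto simp: bilinear_on_def linear_on_def f_def \<phi>.add \<phi>.scale algebra_simps
          L.scale_left_distrib L.scale_right_distrib L.scale_right_diff_distrib)
    fix x y d e assume xy: "x \<in> part L d" "y \<in> part L e"
    show "f x y \<in> part L (d + e + 0)"
      using xy \<phi>(4) L.zero_in_part
      by (cases d; cases e) (auto simp: f_def intro!: part_scale part_diff part_neg)
    show "f x y = - sL (koszul d e) (f y x)"
      using xy \<phi>(4) by (cases d; cases e) (auto simp: f_def koszul_def)
  next
    fix y assume y: "y \<in> carrier_of L" "\<And>x. x \<in> carrier_of L \<Longrightarrow> f x y = 0"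
    have "b \<in> carrier_of L" using \<phi>(2) L.part_subset_carrier by auto
    hence eq: "y = sL (\<phi> y) b" using y(2)[of b] \<phi>(3) by (simp add: f_def)
    have "sL (\<phi> y) x1 = 0" using y(2)[OF x1(1)] x1(3) by (simp add: f_def)
    hence "\<phi> y = 0" using x1(2) by simp
    then show "y = 0" using eq by (metis L.scale_zero_left)
  qed
qed

text \<open>
  If \<open>y\<close> is in the radical of $f(x,y) = \phi(x) y + \phi(y) x$, then \<open>x = b\<close> with $\phi(b) = 1$ shows
  $y = - \phi(y) b$; applying \<open>\<phi>\<close> gives $\phi(y) = - \phi(y)$. Unlike in the skew-symmetric case no second
  basis vector is involved, so the odd line is included; there \<open>N\<close> is the two-dimensional
  algebra with odd \<open>i\<close> and even central $[i,i]$.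
\<close>

lemma capable_if_purely_odd:
  fixes sL :: "'f::field \<Rightarrow> 'l::ab_group_add \<Rightarrow> 'l" and sN :: "'f \<Rightarrow> 'n::ab_group_add \<Rightarrow> 'n"
  assumes "infinite_dimensional sN" and ab: "abelian_superalgebra sL L 0 n"
    and "graded_ideal sL L I" and "n > 0" and two: "(2 :: 'f) \<noteq> 0"
  shows "capable sN sL L I"
proof -
  interpret L: lie_superalgebra sL L
    using ab by (simp add: abelian_superalgebra_def)
  obtain b \<phi> where \<phi>: "Vector_Spaces.linear sL (*) \<phi>" "b \<in> part L 1" "\<phi> b = 1"
    by (rule homogeneous_functional[OF ab, of 1]) (use assms(4) in auto)
  interpret \<phi>: Vector_Spaces.linear sL "(*)" \<phi> by fact
  obtain B where "finite (B 0 \<union> B 1)" "\<And>d. L.span (B d) = part L d" "card (B 0) = 0"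
    by (rule abelian_superalgebra_basis[OF ab]) blast
  hence "part L 0 = {0}" by (metis L.span_empty card_0_eq finite_Un)
  hence even: "x = 0" if "x \<in> part L 0" for x using that by simp
  define f where "f x y = sL (\<phi> x) y + sL (\<phi> y) x" for x y
  note part_scale = L.subspace_scale[OF L.subspace_part]
  note part_add = L.subspace_add[OF L.subspace_part]
  show ?thesis
  proof (rule capable_if_nondegenerate_form[OF assms(1-3), where f = f and s = 1])
    show "bilinear_on sL sL sL (carrier_of L) (carrier_of L) f"
      by (auto simp: bilinear_on_def linear_on_def f_def \<phi>.add \<phi>.scale algebra_simps
          L.scale_left_distrib L.scale_right_distrib)
    fix x y d e assume xy: "x \<in> part L d" "y \<in> part L e"
    show "f x y \<in> part L (d + e + 1)"
      using xy even[of x] even[of y] L.zero_in_part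
      by (cases d; cases e) (auto simp: f_def \<phi>.zero intro!: part_scale part_add)
    show "f x y = - sL (koszul d e) (f y x)"
      using xy even[of x] even[of y]
      by (cases d; cases e) (auto simp: f_def koszul_def \<phi>.zero add.commute)
  next
    fix y assume y: "y \<in> carrier_of L" "\<And>x. x \<in> carrier_of L \<Longrightarrow> f x y = 0"
    have "b \<in> carrier_of L" using \<phi>(2) L.part_subset_carrier by auto
    hence eq: "y = - sL (\<phi> y) b" using y(2)[of b] \<phi>(3) by (simp add: f_def eq_neg_iff_add_eq_0)
    have "\<phi> y = - \<phi> y" using arg_cong[OF eq, of \<phi>] \<phi>(3) by (simp add: \<phi>.neg \<phi>.scale)
    hence "2 * \<phi> y = 0" unfolding mult_2 by (simp only: eq_neg_iff_add_eq_0)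
    hence "\<phi> y = 0" using two by simp
    then show "y = 0" using eq by (metis L.scale_zero_left neg_0_equal_iff_equal)
  qed
qed

section \<open>The one-dimensional even algebra\<close>

text \<open>
  An even lift of \<open>z\<close> exists because the odd part of any lift goes to the odd part of \<open>L\<close>, which is
  zero. Its bracket with itself vanishes in characteristic different from 2, and this bracket is the action of
  \<open>z\<close>, which spans \<open>L\<close>.
\<close>

lemma not_capable_if_even_line:
  fixes sL :: "'f::field \<Rightarrow> 'l::ab_group_add \<Rightarrow> 'l" and sN :: "'f \<Rightarrow> 'n::ab_group_add \<Rightarrow> 'n"
  assumes two: "(2 :: 'f) \<noteq> 0"
    and L: "lie_superalgebra sL L" and odd: "part L 1 = {0}"
    and line: "carrier_of L = module.span sL {x}" and "z \<in> I" "z \<noteq> 0"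
  shows "\<not> capable sN sL L I"
proof
  assume "capable sN sL L I"
  then obtain N \<beta> act where N: "lie_superalgebra sN N" and hom: "lie_hom sN N sL L \<beta>"
    and act: "lie_action sL L sN N act" and im: "\<beta> ` carrier_of N = I"
    and act_br: "\<And>u v. u \<in> carrier_of N \<Longrightarrow> v \<in> carrier_of N \<Longrightarrow> act (\<beta> u) v = bracket N u v"
    and ker: "ker_on N \<beta> = act_centre L N act"
    unfolding capable_def relative_central_extension_def by blast
  interpret L: lie_superalgebra sL L by fact
  interpret N: lie_superalgebra sN N by fact
  obtain a where a: "a \<in> carrier_of N" "\<beta> a = z" using im \<open>z \<in> I\<close> by auto
  then obtain a0 a1 where a01: "a = a0 + a1" "a0 \<in> part N 0" "a1 \<in> part N 1"
    by (auto simp: carrier_of_def)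
  note pN = subsetD[OF N.part_subset_carrier]
  have "\<beta> a1 = 0" using hom a01(3) odd by (auto simp: lie_hom_def)
  hence \<beta>a0: "\<beta> a0 = z"
    using hom a a01 pN by (auto simp: lie_hom_def linear_on_def)
  have "bracket N a0 a0 = - bracket N a0 a0"
    using N.super_skew[OF a01(2,2)] by (simp add: koszul_def)
  hence "sN 2 (bracket N a0 a0) = 0"
    by (simp add: eq_neg_iff_add_eq_0 flip: N.scale_left_distrib[of 1 1, simplified])
  hence "bracket N a0 a0 = 0" using two by simp
  hence z0: "act z a0 = 0" using act_br[of a0 a0] \<beta>a0 a01(2) pN by auto
  have zL: "z \<in> carrier_of L"
    using hom a01(2) \<beta>a0 L.part_subset_carrier by (auto simp: lie_hom_def)
  then obtain c where c: "z = sL c x" using line L.span_singleton by auto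
  have "c \<noteq> 0" using c \<open>z \<noteq> 0\<close> by auto
  have "act l a0 = 0" if "l \<in> carrier_of L" for l
  proof -
    from that obtain d where "l = sL d x" using line L.span_singleton by auto
    hence "l = sL (d / c) z" using c \<open>c \<noteq> 0\<close> by simp
    then show ?thesis
      using act zL z0 a01(2) pN by (auto simp: lie_action_def bilinear_on_def linear_on_def)
  qed
  hence "a0 \<in> act_centre L N act" using a01(2) pN by (auto simp: act_centre_def)
  hence "\<beta> a0 = 0" using ker by (auto simp: ker_on_def)
  thus False using \<beta>a0 \<open>z \<noteq> 0\<close> by simp
qed

lemma graded_ideal_nonzero:
  assumes L: "lie_superalgebra s L" and "graded_ideal s L I" "superdim s L I k h" "k + h \<ge> 1"
  obtains z where "z \<in> I" "z \<in> carrier_of L" "z \<noteq> 0"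
proof -
  interpret L: lie_superalgebra s L by fact
  obtain B0 B1 where B: "card B0 = k" "L.independent B0" "L.span B0 = I \<inter> part L 0"
    "card B1 = h" "L.independent B1" "L.span B1 = I \<inter> part L 1"
    using assms(3) by (auto simp: superdim_def has_dim_def)
  have "B0 \<noteq> {} \<or> B1 \<noteq> {}" using B assms(4) by auto
  then obtain z where z: "z \<in> B0 \<or> z \<in> B1" by blast
  hence "z \<in> L.span B0 \<or> z \<in> L.span B1" using L.span_base by blast
  hence "z \<in> I" "z \<in> carrier_of L" using B L.part_subset_carrier by auto
  moreover have "z \<noteq> 0" using z B L.dependent_zero by metis
  ultimately show ?thesis using that by blast
qed

theorem theorem6p5:
  fixes sL :: "'f::field \<Rightarrow> 'l::ab_group_add \<Rightarrow> 'l"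
    and sN :: "'f \<Rightarrow> 'n::ab_group_add \<Rightarrow> 'n"
    and L :: "'l superalgebra" and I :: "'l set"
    and m n k h :: nat
  assumes "CHAR('f) \<noteq> 2" and "CHAR('f) \<noteq> 3"
    and "infinite_dimensional sN"
    and "abelian_superalgebra sL L m n"
    and "graded_ideal sL L I" and "superdim sL L I k h"
    and "k + h \<ge> 1"
  shows "capable sN sL L I \<longleftrightarrow> (m = 0 \<and> n = 1) \<or> m + n \<ge> 2"
proof -
  interpret L: lie_superalgebra sL L
    using assms(4) by (simp add: abelian_superalgebra_def)
  have two: "(2 :: 'f) \<noteq> 0"
  proof
    assume "(2 :: 'f) = 0"
    hence "CHAR('f) dvd 2" using of_nat_eq_0_iff_char_dvd[of 2, where 'a = 'f] by simp
    hence "CHAR('f) = 1 \<or> CHAR('f) = 2" using two_is_prime_nat by (auto simp: prime_nat_iff)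
    thus False using assms(1) by simp
  qed
  obtain z where z: "z \<in> I" "z \<in> carrier_of L" "z \<noteq> 0"
    by (rule graded_ideal_nonzero[OF L.lie_superalgebra_axioms assms(5-7)])
  obtain B where B: "finite (B 0 \<union> B 1)" "\<And>d. L.span (B d) = part L d"
    "L.span (B 0 \<union> B 1) = carrier_of L" "card (B 0) = m" "card (B 1) = n"
    by (rule abelian_superalgebra_basis[OF assms(4)]) blast
  have "m + n \<noteq> 0"
  proof
    assume "m + n = 0"
    hence "B 0 = {}" "B 1 = {}" using B(1,4,5) by auto
    hence "carrier_of L = {0}" using B(3) by simp
    thus False using z by simp
  qed
  then consider "m = 1" "n = 0" | "m > 0" "m + n \<ge> 2" | "m = 0" "n > 0" by linarith
  then show ?thesis
  proof cases
    case 1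
    have B1: "B 1 = {}" using 1 B(1,5) by auto
    obtain x where x: "B 0 = {x}" using 1 B(4) card_1_singletonE by metis
    have "part L 1 = {0}" using B(2)[of 1] B1 by simp
    moreover have "carrier_of L = L.span {x}" using B(3) B1 x by simp
    ultimately have "\<not> capable sN sL L I"
      using not_capable_if_even_line[OF two L.lie_superalgebra_axioms _ _ z(1,3)] by blast
    then show ?thesis using 1 by simp
  next
    case 2
    then show ?thesis using capable_if_even_part_nonzero[OF assms(3-5)] by simp
  next
    case 3
    then have "capable sN sL L I"
      using capable_if_purely_odd[OF assms(3) _ assms(5) _ two] assms(4) by simp
    then show ?thesis using 3 by linarith
  qed
qed

end
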